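(* Fix $\kappa\in\mathcal K$. Let $\{(s_0^n,b_0^n,b_1^n,s_1^n)\}_{n=1}^\infty\subset\Theta$ with $\lim_{n\to\infty}(s_0^n,b_0^n,b_1^n,s_1^n)=(s_0,b_0,b_1,s_1)\in\Theta$. For each $n$ let $\Upsilon_n:L^1\to L^1$ be the RealLife Euclidean automaton defined by $(s_0^n,b_0^n,b_1^n,s_1^n)$ and $\kappa$, and let $\Upsilon:L^1\to L^1$ be the one defined by $(s_0,b_0,b_1,s_1)$ and $\kappa$. Let ${}^0\!\mathcal A^{\mathbb R^D}$ be defined using $(s_0,b_0,b_1,s_1)$ and $\kappa$. Then: (a) $\lim_{n\to\infty}\|\Upsilon_n(\mathbf a)-\Upsilon(\mathbf a)\|_1=0$ for all $\mathbf a\in{}^0\!\mathcal A^{\mathbb R^D}$. (b) $\{\Upsilon_n\}_{n=1}^\infty$ evolves to $\Upsilon$ on ${}^0\!\mathcal A^{\mathbb R^D}$.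
   Context: Let $D\ge 1$, let $\lambda$ be Lebesgue measure on $\mathbb R^D$, $L^1=L^1(\mathbb R^D,\lambda)$. $\mathcal A^{\mathbb R^D}$ is the set of Borel-measurable functions $\mathbf a:\mathbb R^D\to\{0,1\}$; ${}^1\!\mathcal A^{\mathbb R^D}=\mathcal A^{\mathbb R^D}\cap L^1$. $\mathcal K$ is the set of $\kappa\in L^\infty(\mathbb R^D;[0,\infty))$ with compact support and $\int\kappa\,d\lambda=1$; $(\kappa*\mathbf a)(x)=\int\kappa(y)\mathbf a(x-y)\,d\lambda(y)$. $\Theta=\{(s_0,b_0,b_1,s_1): 0<s_0\le b_0<b_1\le s_1\le 1\}$. The RealLife Euclidean automaton defined by $(s_0,b_0,b_1,s_1)\in\Theta$ and $\kappa\in\mathcal K$ is the map $\Upsilon:L^1\to L^1$, $$\Upsilon(\mathbf a)(x)=\mathbf a(x)\,\mathbf 1_{[s_0,s_1]}(\kappa*\mathbf a(x))+(1-\mathbf a(x))\,\mathbf 1_{[b_0,b_1]}(\kappa*\mathbf a(x)).$$ ${}^0\!\mathcal A^{\mathbb R^D}=\{\mathbf a\in{}^1\!\mathcal A^{\mathbb R^D}: \lambda\{x:\kappa*\mathbf a(x)\in\{s_0,b_0,b_1,s_1\}\}=0\}$. Shifts: $\sigma^v(\mathbf a)(x)=\mathbf a(x+v)$, $v\in\mathbb R^D$. Evolution: let $\Phi,\Phi_n:L^1\to L^1$ ($n\in\mathbb N$) commute with all shifts, and let $\mathfrak A\subset L^1$ be shift-invariant. $\{\Phi_n\}$ evolves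 to $\Phi$ on $\mathfrak A$ if, for every sequence $\{\mathbf a_n\}\subset L^1$ converging in $L^1$ to some $\mathbf a\in\mathfrak A$: (1) if $\Phi_n(\mathbf a_n)=\mathbf a_n$ for all $n$, then $\Phi(\mathbf a)=\mathbf a$; (2) for every $P\in\mathbb N$ such that $\Phi^p(\mathbf a)\in\mathfrak A$ for all $0\le p<P$: [i] if $\Phi_n^P(\mathbf a_n)=\mathbf a_n$ for all $n$, then $\Phi^P(\mathbf a)=\mathbf a$; [ii] if $v_n\to v$ in $\mathbb R^D$ and $\Phi_n^P(\mathbf a_n)=\sigma^{Pv_n}(\mathbf a_n)$ for all $n$, then $\Phi^P(\mathbf a)=\sigma^{Pv}(\mathbf a)$. *)

theory Defs
  imports "HOL-Analysis.Analysis"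
begin

text \<open>
  Elements of \<open>L\<^sup>1(\<real>\<^sup>D, \<lambda>)\<close> are represented by Borel functions that are integrable
  with respect to Lebesgue measure \<^const>\<open>lborel\<close>; equality in \<open>L\<^sup>1\<close> is equality almost everywhere,
  written \<open>L1_eq\<close>. Since the index type \<open>'d\<close> is nonempty, \<open>D = CARD('d) \<ge> 1\<close>.
\<close>

definition L1 :: "(real ^ 'd \<Rightarrow> real) set" where
  "L1 = {a. integrable lborel a}"

definition L1_eq :: "(real ^ 'd \<Rightarrow> real) \<Rightarrow> (real ^ 'd \<Rightarrow> real) \<Rightarrow> bool" where
  "L1_eq a b \<longleftrightarrow> (AE x in lborel. a x = b x)"

text \<open>
  The norm takes values in \<^typ>\<open>ennreal\<close>, so that a non-integrable function does not
  get norm zero by convention.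
\<close>

definition L1_norm :: "(real ^ 'd \<Rightarrow> real) \<Rightarrow> ennreal" where
  "L1_norm a = (\<integral>\<^sup>+ x. ennreal \<bar>a x\<bar> \<partial>lborel)"

definition L1_tendsto :: "(nat \<Rightarrow> real ^ 'd \<Rightarrow> real) \<Rightarrow> (real ^ 'd \<Rightarrow> real) \<Rightarrow> bool" where
  "L1_tendsto as a \<longleftrightarrow> (\<lambda>n. L1_norm (\<lambda>x. as n x - a x)) \<longlonglongrightarrow> 0"

text \<open>
  A set \<open>A\<close> of functions, read as a subset of \<open>L\<^sup>1\<close>, consists of the classes of its members:
  a function represents an element of it iff it is almost everywhere equal to a member of \<open>A\<close>.
\<close>

definition L1_classes :: "(real ^ 'd \<Rightarrow> real) set \<Rightarrow> (real ^ 'd \<Rightarrow> real) set" where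
  "L1_classes A = {a \<in> L1. \<exists>b\<in>A. L1_eq a b}"

text \<open>The operators on functions that induce a map from \<open>L\<^sup>1\<close> to \<open>L\<^sup>1\<close>.\<close>

definition L1_map :: "((real ^ 'd \<Rightarrow> real) \<Rightarrow> real ^ 'd \<Rightarrow> real) \<Rightarrow> bool" where
  "L1_map \<Phi> \<longleftrightarrow> (\<forall>a\<in>L1. \<Phi> a \<in> L1) \<and> (\<forall>a\<in>L1. \<forall>b\<in>L1. L1_eq a b \<longrightarrow> L1_eq (\<Phi> a) (\<Phi> b))"

definition shift :: "real ^ 'd \<Rightarrow> (real ^ 'd \<Rightarrow> real) \<Rightarrow> real ^ 'd \<Rightarrow> real" where
  "shift v a = (\<lambda>x. a (x + v))"

definition commutes_with_shifts :: "((real ^ 'd \<Rightarrow> real) \<Rightarrow> real ^ 'd \<Rightarrow> real) \<Rightarrow> bool" where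
  "commutes_with_shifts \<Phi> \<longleftrightarrow> (\<forall>v. \<forall>a\<in>L1. L1_eq (\<Phi> (shift v a)) (shift v (\<Phi> a)))"

definition shift_invariant :: "(real ^ 'd \<Rightarrow> real) set \<Rightarrow> bool" where
  "shift_invariant A \<longleftrightarrow> (\<forall>v. \<forall>a\<in>L1_classes A. shift v a \<in> L1_classes A)"

text \<open>
  The standing assumptions on \<open>\<Phi>\<^sub>n\<close>, \<open>\<Phi>\<close> and \<open>A\<close> under which evolution is defined are the first
  conjuncts of the definition, so they form part of every claim that one family evolves to a map.
\<close>

definition evolves_to_on ::
  "(nat \<Rightarrow> (real ^ 'd \<Rightarrow> real) \<Rightarrow> real ^ 'd \<Rightarrow> real)
    \<Rightarrow> ((real ^ 'd \<Rightarrow> real) \<Rightarrow> real ^ 'd \<Rightarrow> real) \<Rightarrow> (real ^ 'd \<Rightarrow> real) set \<Rightarrow> bool" where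
  "evolves_to_on \<Phi>s \<Phi> A \<longleftrightarrow>
     (\<forall>n. L1_map (\<Phi>s n) \<and> commutes_with_shifts (\<Phi>s n)) \<and>
     L1_map \<Phi> \<and> commutes_with_shifts \<Phi> \<and>
     A \<subseteq> L1 \<and> shift_invariant A \<and>
     (\<forall>as a. (\<forall>n. as n \<in> L1) \<and> a \<in> L1_classes A \<and> L1_tendsto as a \<longrightarrow>
        ((\<forall>n. L1_eq (\<Phi>s n (as n)) (as n)) \<longrightarrow> L1_eq (\<Phi> a) a) \<and>
        (\<forall>P::nat. (\<forall>p<P. (\<Phi> ^^ p) a \<in> L1_classes A) \<longrightarrow>
           ((\<forall>n. L1_eq ((\<Phi>s n ^^ P) (as n)) (as n)) \<longrightarrow> L1_eq ((\<Phi> ^^ P) a) a) \<and>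
           (\<forall>vs v. vs \<longlonglongrightarrow> v \<and>
              (\<forall>n. L1_eq ((\<Phi>s n ^^ P) (as n)) (shift (real P *\<^sub>R vs n) (as n))) \<longrightarrow>
              L1_eq ((\<Phi> ^^ P) a) (shift (real P *\<^sub>R v) a))))"

text \<open>
  The kernels are elements of \<open>L\<^sup>\<infinity>\<close>, so boundedness, nonnegativity and the support condition
  are imposed almost everywhere.
\<close>

definition kernels :: "(real ^ 'd \<Rightarrow> real) set" where
  "kernels = {\<kappa> \<in> borel_measurable borel.
     (\<exists>C. AE x in lborel. \<bar>\<kappa> x\<bar> \<le> C) \<and>
     (AE x in lborel. 0 \<le> \<kappa> x) \<and>
     (\<exists>K. compact K \<and> (AE x in lborel. x \<notin> K \<longrightarrow> \<kappa> x = 0)) \<and>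
     (LINT x|lborel. \<kappa> x) = 1}"

definition conv :: "(real ^ 'd \<Rightarrow> real) \<Rightarrow> (real ^ 'd \<Rightarrow> real) \<Rightarrow> real ^ 'd \<Rightarrow> real" where
  "conv \<kappa> a x = (LINT y|lborel. \<kappa> y * a (x - y))"

text \<open>Parameter tuples are ordered as \<open>(s\<^sub>0, b\<^sub>0, b\<^sub>1, s\<^sub>1)\<close>.\<close>

type_synonym params = "real \<times> real \<times> real \<times> real"

definition Theta :: "params set" where
  "Theta = {(s0, b0, b1, s1). 0 < s0 \<and> s0 \<le> b0 \<and> b0 < b1 \<and> b1 \<le> s1 \<and> s1 \<le> 1}"

definition reallife ::
  "params \<Rightarrow> (real ^ 'd \<Rightarrow> real) \<Rightarrow> (real ^ 'd \<Rightarrow> real) \<Rightarrow> real ^ 'd \<Rightarrow> real" where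
  "reallife \<theta> \<kappa> a x = (case \<theta> of (s0, b0, b1, s1) \<Rightarrow>
     a x * indicat_real {s0..s1} (conv \<kappa> a x)
     + (1 - a x) * indicat_real {b0..b1} (conv \<kappa> a x))"

definition configs :: "(real ^ 'd \<Rightarrow> real) set" where
  "configs = {a \<in> borel_measurable borel. \<forall>x. a x \<in> {0, 1}}"

definition configs1 :: "(real ^ 'd \<Rightarrow> real) set" where
  "configs1 = configs \<inter> L1"

definition configs0 :: "params \<Rightarrow> (real ^ 'd \<Rightarrow> real) \<Rightarrow> (real ^ 'd \<Rightarrow> real) set" where
  "configs0 \<theta> \<kappa> = (case \<theta> of (s0, b0, b1, s1) \<Rightarrow>
     {a \<in> configs1. {x. conv \<kappa> a x \<in> {s0, b0, b1, s1}} \<in> null_sets lborel})"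

end

theory Submission
  imports Defs
begin

text \<open>
  The heart of the matter is joint continuity: if \<open>a\<^sub>n \<rightarrow> a\<close> in \<open>L\<^sup>1\<close> and \<open>\<kappa> * a\<close> almost never hits one of
  the four thresholds of \<open>\<Upsilon>\<close>, then \<open>\<Upsilon>\<^sub>n(a\<^sub>n) \<rightarrow> \<Upsilon>(a)\<close> in \<open>L\<^sup>1\<close>. Since \<open>\<kappa>\<close> is bounded, \<open>\<kappa> * a\<^sub>n \<rightarrow> \<kappa> * a\<close>
  uniformly, so the indicators in \<open>\<Upsilon>\<^sub>n(a\<^sub>n)\<close> converge almost everywhere, and once
  \<open>b\<^sub>0\<^sup>n - \<parallel>\<kappa> * a\<^sub>n - \<kappa> * a\<parallel> > b\<^sub>0/2\<close> they are dominated as in Markov's inequality by means of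
  \<open>|\<kappa> * a| / (b\<^sub>0/2)\<close>. Taking \<open>a\<^sub>n = a\<close> gives (a). Iterating it gives \<open>\<Upsilon>\<^sub>n\<^sup>P(a\<^sub>n) \<rightarrow> \<Upsilon>\<^sup>P(a)\<close>, and continuity
  of translations in \<open>L\<^sup>1\<close> lets the equations that define
  fixed points, periodic points and travelling patterns pass to the limit.
\<close>

section \<open>Invariance of Lebesgue measure under reflections and translations\<close>

lemma lborel_distr_reflect:
  fixes v :: "'a::euclidean_space"
  shows "distr lborel borel (\<lambda>y. v - y) = lborel"
  by (subst lborel_affine[of "-1" v]) (auto simp: density_1)

lemma nn_integral_lborel_reflect:
  fixes v :: "'a::euclidean_space"
  assumes [measurable]: "f \<in> borel_measurable borel"
  shows "(\<integral>\<^sup>+y. f (v - y) \<partial>lborel) = (\<integral>\<^sup>+y. f y \<partial>lborel)"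
  by (subst (2) lborel_distr_reflect[of v, symmetric], subst nn_integral_distr) auto

lemma nn_integral_lborel_translate:
  fixes v :: "'a::euclidean_space"
  assumes [measurable]: "f \<in> borel_measurable borel"
  shows "(\<integral>\<^sup>+y. f (y + v) \<partial>lborel) = (\<integral>\<^sup>+y. f y \<partial>lborel)"
  by (subst (2) lborel_distr_plus[of v, symmetric], subst nn_integral_distr) (auto simp: add.commute)

lemma AE_lborel_reflect:
  fixes v :: "'a::euclidean_space"
  assumes "AE y in lborel. P y"
  shows "AE y in lborel. P (v - y)"
  by (rule AE_distrD[of _ lborel borel]) (simp_all only: lborel_distr_reflect assms, measurable)

lemma AE_lborel_translate:
  fixes v :: "'a::euclidean_space"
  assumes "AE y in lborel. P y"
  shows "AE y in lborel. P (y + v)"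
  unfolding add.commute[of _ v]
  by (rule AE_distrD[of _ lborel borel]) (simp_all only: lborel_distr_plus assms, measurable)

lemma integrable_lborel_reflect:
  fixes v :: "'a::euclidean_space" and f :: "'a \<Rightarrow> real"
  assumes "integrable lborel f"
  shows "integrable lborel (\<lambda>y. f (v - y))"
proof -
  have [measurable]: "f \<in> borel_measurable borel"
    using assms by simp
  show ?thesis
    using assms nn_integral_lborel_reflect[of "\<lambda>y. ennreal (norm (f y))" v]
    unfolding integrable_iff_bounded by simp
qed

lemma integrable_lborel_translate:
  fixes v :: "'a::euclidean_space" and f :: "'a \<Rightarrow> real"
  assumes "integrable lborel f"
  shows "integrable lborel (\<lambda>y. f (y + v))"
proof -
  have [measurable]: "f \<in> borel_measurable borel"
    using assms by simp
  show ?thesis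
    using assms nn_integral_lborel_translate[of "\<lambda>y. ennreal (norm (f y))" v]
    unfolding integrable_iff_bounded by simp
qed

lemma integral_lborel_reflect:
  fixes v :: "'a::euclidean_space" and f :: "'a \<Rightarrow> real"
  assumes [measurable]: "f \<in> borel_measurable borel"
  shows "(LINT y|lborel. f (v - y)) = (LINT y|lborel. f y)"
  by (subst (2) lborel_distr_reflect[of v, symmetric], subst integral_distr) auto

lemma integral_lborel_translate:
  fixes v :: "'a::euclidean_space" and f :: "'a \<Rightarrow> real"
  assumes [measurable]: "f \<in> borel_measurable borel"
  shows "(LINT y|lborel. f (y + v)) = (LINT y|lborel. f y)"
  by (subst (2) lborel_distr_plus[of v, symmetric], subst integral_distr) (auto simp: add.commute)

section \<open>The L1 norm and L1 convergence\<close>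

lemma L1_measurable: "a \<in> L1 \<Longrightarrow> a \<in> borel_measurable borel"
  by (auto simp: L1_def dest: borel_measurable_integrable)

lemma L1_diff: "a \<in> L1 \<Longrightarrow> b \<in> L1 \<Longrightarrow> (\<lambda>x. a x - b x) \<in> L1"
  by (simp add: L1_def)

lemma L1_shift: "a \<in> L1 \<Longrightarrow> shift v a \<in> L1"
  by (simp add: L1_def shift_def integrable_lborel_translate)

lemma L1_norm_eq_integral: "a \<in> L1 \<Longrightarrow> L1_norm a = ennreal (LINT x|lborel. \<bar>a x\<bar>)"
  unfolding L1_norm_def L1_def by (subst nn_integral_eq_integral) auto

lemma L1_norm_triangle:
  assumes [measurable]: "f \<in> borel_measurable borel" "g \<in> borel_measurable borel"
    and "AE x in lborel. \<bar>h x\<bar> \<le> \<bar>f x\<bar> + \<bar>g x\<bar>"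
  shows "L1_norm h \<le> L1_norm f + L1_norm g"
proof -
  have "L1_norm h \<le> (\<integral>\<^sup>+x. ennreal \<bar>f x\<bar> + ennreal \<bar>g x\<bar> \<partial>lborel)"
    unfolding L1_norm_def
    using assms(3) by (intro nn_integral_mono_AE) (auto simp flip: ennreal_plus)
  also have "\<dots> = L1_norm f + L1_norm g"
    unfolding L1_norm_def by (intro nn_integral_add) auto
  finally show ?thesis .
qed

lemma L1_norm_diff_triangle:
  assumes "f \<in> borel_measurable borel" "g \<in> borel_measurable borel" "h \<in> borel_measurable borel"
  shows "L1_norm (\<lambda>x. f x - h x) \<le> L1_norm (\<lambda>x. f x - g x) + L1_norm (\<lambda>x. g x - h x)"
  using assms by (intro L1_norm_triangle) auto

lemma L1_norm_minus_commute: "L1_norm (\<lambda>x. f x - g x) = L1_norm (\<lambda>x. g x - f x)"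
  by (simp add: L1_norm_def abs_minus_commute)

lemma L1_norm_shift:
  assumes [measurable]: "a \<in> borel_measurable borel"
  shows "L1_norm (shift v a) = L1_norm a"
  unfolding L1_norm_def shift_def
  by (rule nn_integral_lborel_translate[of "\<lambda>x. ennreal \<bar>a x\<bar>"]) measurable

lemma L1_eq_iff_norm:
  assumes [measurable]: "a \<in> borel_measurable borel" "b \<in> borel_measurable borel"
  shows "L1_eq a b \<longleftrightarrow> L1_norm (\<lambda>x. a x - b x) = 0"
  unfolding L1_norm_def L1_eq_def by (subst nn_integral_0_iff_AE) auto

text \<open>Lets an equation between classes pass to the limit. Where \<open>as n\<close> and
  \<open>bs n\<close> agree, \<open>a - b\<close> is bounded by
  \<open>\<bar>as n - a\<bar> + \<bar>bs n - b\<bar>\<close>, so the norm of \<open>a - b\<close>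
  lies below a null sequence.\<close>

lemma L1_tendsto_unique:
  assumes "\<And>n. as n \<in> L1" "\<And>n. bs n \<in> L1" "\<And>n. L1_eq (as n) (bs n)" "a \<in> L1" "b \<in> L1"
    and as: "L1_tendsto as a" and bs: "L1_tendsto bs b"
  shows "L1_eq a b"
proof -
  note [measurable] = assms(1,2,4,5)[THEN L1_measurable]
  have "L1_norm (\<lambda>x. a x - b x) \<le> L1_norm (\<lambda>x. as n x - a x) + L1_norm (\<lambda>x. bs n x - b x)" for n
    using assms(3)[of n] by (intro L1_norm_triangle) (auto simp: L1_eq_def elim!: eventually_mono)
  moreover have "(\<lambda>n. L1_norm (\<lambda>x. as n x - a x) + L1_norm (\<lambda>x. bs n x - b x)) \<longlonglongrightarrow> 0 + 0"
    using as bs unfolding L1_tendsto_def by (intro tendsto_add)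
  ultimately have "L1_norm (\<lambda>x. a x - b x) \<le> 0"
    using LIMSEQ_le_const by fastforce
  then show ?thesis
    by (simp add: L1_eq_iff_norm)
qed

lemma L1_tendsto_squeeze:
  assumes "\<And>n. L1_norm (\<lambda>x. bs n x - b x) \<le> f n" "f \<longlonglongrightarrow> 0"
  shows "L1_tendsto bs b"
  unfolding L1_tendsto_def
  by (rule tendsto_sandwich[OF _ _ tendsto_const assms(2)]) (auto simp: assms(1))

section \<open>Continuity of translations in L1\<close>

text \<open>A three-epsilon argument: translation preserves the norm, so the translates of
  \<open>f\<close> and \<open>g\<close> are as close as \<open>f\<close> and \<open>g\<close>
  themselves, and only the middle term depends on \<open>n\<close>.\<close>

lemma L1_tendsto_shift_approx:
  assumes f [measurable]: "f \<in> borel_measurable borel"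
    and approx: "\<And>e::real. e > 0 \<Longrightarrow> \<exists>g \<in> borel_measurable borel.
      L1_tendsto (\<lambda>n. shift (h n) g) g \<and> L1_norm (\<lambda>x. f x - g x) \<le> ennreal e"
  shows "L1_tendsto (\<lambda>n. shift (h n) f) f"
  unfolding L1_tendsto_def
proof (rule order_tendstoI)
  fix e :: ennreal assume "e > 0"
  then obtain c where c: "0 < c" "c < e"
    using dense by blast
  \<comment> \<open>The bound \<open>e\<close> may be infinite; a value strictly below it is finite
    and can be split into three real parts.\<close>
  then obtain d where "0 \<le> d" "c = ennreal d"
    by (cases c) auto
  with c have d: "d > 0" "ennreal d < e"
    by (auto simp: ennreal_less_zero_iff)
  obtain g where [measurable]: "g \<in> borel_measurable borel"
    and g: "L1_tendsto (\<lambda>n. shift (h n) g) g" "L1_norm (\<lambda>x. f x - g x) \<le> ennreal (d / 3)"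
    using approx[of "d / 3"] d by auto
  have [measurable]: "shift w f \<in> borel_measurable borel" "shift w g \<in> borel_measurable borel" for w
    by (simp_all add: shift_def)
  have "eventually (\<lambda>n. L1_norm (\<lambda>x. shift (h n) g x - g x) < ennreal (d / 3)) sequentially"
    using g(1) d by (intro order_tendstoD(2)[where y = 0]) (auto simp: L1_tendsto_def)
  then show "eventually (\<lambda>n. L1_norm (\<lambda>x. shift (h n) f x - f x) < e) sequentially"
  proof eventually_elim
    case (elim n)
    have "L1_norm (\<lambda>x. shift (h n) f x - shift (h n) g x) = L1_norm (shift (h n) (\<lambda>x. f x - g x))"
      by (simp add: shift_def)
    then have 1: "L1_norm (\<lambda>x. shift (h n) f x - shift (h n) g x) \<le> ennreal (d / 3)"
      using g(2) by (simp add: L1_norm_shift)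
    have "L1_norm (\<lambda>x. shift (h n) f x - f x) \<le>
      L1_norm (\<lambda>x. shift (h n) f x - shift (h n) g x) + L1_norm (\<lambda>x. shift (h n) g x - f x)"
      by (rule L1_norm_diff_triangle) auto
    also have "L1_norm (\<lambda>x. shift (h n) g x - f x) \<le>
      L1_norm (\<lambda>x. shift (h n) g x - g x) + L1_norm (\<lambda>x. g x - f x)"
      by (rule L1_norm_diff_triangle) auto
    also have "L1_norm (\<lambda>x. shift (h n) f x - shift (h n) g x) +
      (L1_norm (\<lambda>x. shift (h n) g x - g x) + L1_norm (\<lambda>x. g x - f x))
      \<le> ennreal (d / 3) + (ennreal (d / 3) + ennreal (d / 3))"
      using 1 elim g(2) by (intro add_mono) (auto simp: L1_norm_minus_commute[of g])
    also have "\<dots> = ennreal d"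
      using d by (simp flip: ennreal_plus)
    finally show ?case using d by simp
  qed
qed simp

text \<open>
  For an open set \<open>U\<close> the indicators of \<open>U \<inter> (U - h\<^sub>n)\<close> converge pointwise to that of \<open>U\<close> and are
  dominated by it, although \<open>U - h\<^sub>n\<close> itself has no common majorant.
\<close>

lemma L1_tendsto_shift_indicator_open:
  fixes U :: "(real ^ 'd) set"
  assumes "open U" and fin: "emeasure lborel U < \<infinity>" and h: "h \<longlonglongrightarrow> 0"
  shows "L1_tendsto (\<lambda>n. shift (h n) (indicat_real U)) (indicat_real U)"
proof -
  have [measurable]: "U \<in> sets borel" using \<open>open U\<close> by simp
  let ?u = "indicat_real U"
  have int: "integrable lborel ?u"
    using fin by (simp add: integrable_indicator_iff)
  have ints: "integrable lborel (\<lambda>x. ?u (x + v))" for v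
    using int by (rule integrable_lborel_translate)
  have int_eq: "(LINT x|lborel. ?u (x + v)) = (LINT x|lborel. ?u x)" for v
    by (rule integral_lborel_translate) simp
  have intm: "integrable lborel (\<lambda>x. ?u (x + v) * ?u x)" for v
    by (rule Bochner_Integration.integrable_bound[OF int]) (auto simp: indicator_def)
  have "(\<lambda>n. LINT x|lborel. ?u (x + h n) * ?u x) \<longlonglongrightarrow> (LINT x|lborel. ?u x)"
  proof (rule integral_dominated_convergence[where w = ?u])
    show "AE x in lborel. (\<lambda>n. ?u (x + h n) * ?u x) \<longlonglongrightarrow> ?u x"
    proof (rule AE_I2)
      fix x
      show "(\<lambda>n. ?u (x + h n) * ?u x) \<longlonglongrightarrow> ?u x"
      proof (cases "x \<in> U")
        case True
        have "(\<lambda>n. x + h n) \<longlonglongrightarrow> x + 0" by (intro tendsto_intros h)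
        then have "eventually (\<lambda>n. x + h n \<in> U) sequentially"
          using True \<open>open U\<close> by (intro topological_tendstoD[where l = x]) auto
        then show ?thesis
          using True by (intro tendsto_eventually) (auto elim!: eventually_mono)
      qed auto
    qed
  qed (auto simp: int indicator_def)
  then have "(\<lambda>n. 2 * (LINT x|lborel. ?u x) - 2 * (LINT x|lborel. ?u (x + h n) * ?u x))
      \<longlonglongrightarrow> 2 * (LINT x|lborel. ?u x) - 2 * (LINT x|lborel. ?u x)"
    by (intro tendsto_intros)
  moreover have "L1_norm (\<lambda>x. shift (h n) ?u x - ?u x) =
    ennreal (2 * (LINT x|lborel. ?u x) - 2 * (LINT x|lborel. ?u (x + h n) * ?u x))" for n
  proof -
    have "(\<lambda>x. shift (h n) ?u x - ?u x) \<in> L1"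
      using int ints by (auto simp: L1_def shift_def)
    then have "L1_norm (\<lambda>x. shift (h n) ?u x - ?u x) = ennreal (LINT x|lborel. \<bar>?u (x + h n) - ?u x\<bar>)"
      by (simp add: L1_norm_eq_integral shift_def)
    \<comment> \<open>For p and q in {0, 1}, the distance of p and q is p + q - 2pq. The two single
      integrals agree by translation invariance, so only the integral of the product depends on
      \<open>n\<close>.\<close>
    also have "(LINT x|lborel. \<bar>?u (x + h n) - ?u x\<bar>)
        = (LINT x|lborel. ?u (x + h n) + ?u x - 2 * (?u (x + h n) * ?u x))"
      by (intro Bochner_Integration.integral_cong) (auto simp: indicator_def)
    also have "\<dots> = 2 * (LINT x|lborel. ?u x) - 2 * (LINT x|lborel. ?u (x + h n) * ?u x)"
      using int ints intm int_eq by simp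
    finally show ?thesis .
  qed
  ultimately show ?thesis
    unfolding L1_tendsto_def by (auto dest: tendsto_ennrealI)
qed

text \<open>Induction over integrable functions: indicators of measurable sets are approximated by
  those of open supersets, sums follow from the triangle inequality, and limits are approximated in
  L1 by the functions that converge to them.\<close>

lemma L1_tendsto_shift_0:
  fixes f :: "real ^ 'd \<Rightarrow> real"
  assumes "integrable lborel f" and h: "h \<longlonglongrightarrow> 0"
  shows "L1_tendsto (\<lambda>n. shift (h n) f) f"
  using assms(1)
proof (induction rule: integrable_induct)
  case (base A c)
  then have [measurable]: "A \<in> sets borel" by simp
  show ?case
  proof (rule L1_tendsto_shift_approx)
    fix e :: real assume "e > 0"
    \<comment> \<open>The summand 1 keeps the quotient meaningful for \<open>c = 0\<close>; after
      multiplication by \<open>\<bar>c\<bar>\<close> the error is still at most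
      \<open>e\<close>.\<close>
    obtain U where U: "open U" "A \<subseteq> U" "emeasure lborel (U - A) < ennreal (e / (\<bar>c\<bar> + 1))"
      using outer_regular_lborel[of A "e / (\<bar>c\<bar> + 1)"] \<open>e > 0\<close> by auto
    have [measurable]: "U \<in> sets borel" using U by simp
    have "emeasure lborel U \<le> emeasure lborel A + emeasure lborel (U - A)"
      using U by (subst plus_emeasure) (auto simp: Un_absorb1)
    also have "\<dots> < \<infinity>"
      using base U(3) by (auto simp: less_top[symmetric] dest: order_less_le_trans)
    finally have U_fin: "emeasure lborel U < \<infinity>" .
    let ?g = "\<lambda>x. indicat_real U x * c"
    have scale: "L1_norm (\<lambda>x. k x * c) = L1_norm k * ennreal \<bar>c\<bar>"
      if [measurable]: "k \<in> borel_measurable borel" for k :: "real ^ 'd \<Rightarrow> real"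
      unfolding L1_norm_def by (simp add: abs_mult ennreal_mult nn_integral_multc)
    have "L1_norm (\<lambda>x. shift (h n) ?g x - ?g x)
       = L1_norm (\<lambda>x. shift (h n) (indicat_real U) x - indicat_real U x) * ennreal \<bar>c\<bar>" for n
      by (subst scale[symmetric]) (simp_all add: shift_def left_diff_distrib)
    moreover have "(\<lambda>n. L1_norm (\<lambda>x. shift (h n) (indicat_real U) x - indicat_real U x) * ennreal \<bar>c\<bar>)
        \<longlonglongrightarrow> 0 * ennreal \<bar>c\<bar>"
      using L1_tendsto_shift_indicator_open[OF U(1) U_fin h]
      by (intro tendsto_mult_ennreal tendsto_const) (auto simp: L1_tendsto_def)
    ultimately have "L1_tendsto (\<lambda>n. shift (h n) ?g) ?g"
      by (simp add: L1_tendsto_def)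
    moreover have "L1_norm (\<lambda>x. indicator A x *\<^sub>R c - ?g x) \<le> ennreal e"
    proof -
      have "L1_norm (\<lambda>x. indicator A x *\<^sub>R c - ?g x)
          = L1_norm (\<lambda>x. (indicat_real A x - indicat_real U x) * c)"
        by (simp add: left_diff_distrib)
      also have "\<dots> = L1_norm (\<lambda>x. indicat_real A x - indicat_real U x) * ennreal \<bar>c\<bar>"
        by (rule scale) simp
      also have "L1_norm (\<lambda>x. indicat_real A x - indicat_real U x)
          = (\<integral>\<^sup>+x. indicator (U - A) x \<partial>lborel)"
        unfolding L1_norm_def using U(2)
        by (intro nn_integral_cong) (auto simp: indicator_def)
      also have "\<dots> = emeasure lborel (U - A)" by simp
      also have "emeasure lborel (U - A) * ennreal \<bar>c\<bar> \<le> ennreal (e / (\<bar>c\<bar> + 1)) * ennreal \<bar>c\<bar>"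
        using U(3) by (intro mult_right_mono) auto
      also have "\<dots> = ennreal (e / (\<bar>c\<bar> + 1) * \<bar>c\<bar>)"
        using \<open>e > 0\<close> by (subst ennreal_mult) auto
      also have "\<dots> \<le> ennreal e"
        using \<open>e > 0\<close> by (intro ennreal_leI) (simp add: field_simps)
      finally show ?thesis .
    qed
    ultimately show "\<exists>g\<in>borel_measurable borel. L1_tendsto (\<lambda>n. shift (h n) g) g \<and>
        L1_norm (\<lambda>x. indicator A x *\<^sub>R c - g x) \<le> ennreal e"
      by (intro bexI[of _ ?g]) auto
  qed simp
next
  case (add f g)
  then have [measurable]: "f \<in> borel_measurable borel" "g \<in> borel_measurable borel" by auto
  show ?case
  proof (rule L1_tendsto_squeeze)
    show "(\<lambda>n. L1_norm (\<lambda>x. shift (h n) f x - f x) + L1_norm (\<lambda>x. shift (h n) g x - g x)) \<longlonglongrightarrow> 0"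
      using tendsto_add[OF add.IH[unfolded L1_tendsto_def]] by simp
  qed (auto intro!: L1_norm_triangle simp: shift_def)
next
  case (lim f s)
  then have [measurable]: "f \<in> borel_measurable borel" "\<And>i. s i \<in> borel_measurable borel" by auto
  show ?case
  proof (rule L1_tendsto_shift_approx)
    fix e :: real assume "e > 0"
    have "(\<lambda>i. \<integral>\<^sup>+x. norm (f x - s i x) \<partial>lborel) \<longlonglongrightarrow> 0"
    \<comment> \<open>The majorant comes from the induction principle, whose approximants satisfy
      \<open>norm (s i x) \<le> 2 * norm (f x)\<close>.\<close>
    proof (rule nn_integral_dominated_convergence_norm[where w = "\<lambda>x. 2 * norm (f x)"])
      have "integrable lborel (\<lambda>x. 2 * norm (f x))" using lim by auto
      then show "(\<integral>\<^sup>+ x. ennreal (2 * norm (f x)) \<partial>lborel) < \<infinity>"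
        by (subst (asm) integrable_iff_bounded) simp
    qed (use lim in auto)
    then have "eventually (\<lambda>i. L1_norm (\<lambda>x. f x - s i x) < ennreal e) sequentially"
      using \<open>e > 0\<close> unfolding L1_norm_def by (intro order_tendstoD(2)[where y = 0]) auto
    then obtain i where "L1_norm (\<lambda>x. f x - s i x) < ennreal e"
      by (auto simp: eventually_sequentially)
    then show "\<exists>g\<in>borel_measurable borel. L1_tendsto (\<lambda>n. shift (h n) g) g \<and>
        L1_norm (\<lambda>x. f x - g x) \<le> ennreal e"
      using lim by (intro bexI[of _ "s i"]) auto
  qed simp
qed

text \<open>Comparison with \<open>shift (ws n) a\<close> splits the error into two translates, of
  \<open>as n - a\<close> and of \<open>shift (ws n - w) a - a\<close>. Norm invariance removes the
  outer translations, and \<open>ws n - w\<close> tends to 0.\<close>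

lemma L1_tendsto_shift:
  assumes "\<And>n. as n \<in> L1" "a \<in> L1" "L1_tendsto as a" "ws \<longlonglongrightarrow> w"
  shows "L1_tendsto (\<lambda>n. shift (ws n) (as n)) (shift w a)"
proof (rule L1_tendsto_squeeze)
  note [measurable] = assms(1,2)[THEN L1_measurable]
  have m [measurable]: "shift v b \<in> borel_measurable borel" if [measurable]: "b \<in> borel_measurable borel"
    for v :: "real ^ 'a" and b
    by (simp add: shift_def)
  let ?f = "\<lambda>n. L1_norm (\<lambda>x. as n x - a x) + L1_norm (\<lambda>x. shift (ws n - w) a x - a x)"
  have "(\<lambda>n. ws n - w) \<longlonglongrightarrow> 0"
    using assms(4) by (simp add: LIM_zero)
  then have "L1_tendsto (\<lambda>n. shift (ws n - w) a) a"
    using assms(2) by (intro L1_tendsto_shift_0) (auto simp: L1_def)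
  from tendsto_add[OF assms(3)[unfolded L1_tendsto_def] this[unfolded L1_tendsto_def]]
  show "?f \<longlonglongrightarrow> 0" by simp
  fix n
  have "L1_norm (\<lambda>x. shift (ws n) (as n) x - shift w a x)
     \<le> L1_norm (\<lambda>x. shift (ws n) (as n) x - shift (ws n) a x) + L1_norm (\<lambda>x. shift (ws n) a x - shift w a x)"
    by (rule L1_norm_diff_triangle) auto
  also have "(\<lambda>x. shift (ws n) (as n) x - shift (ws n) a x) = shift (ws n) (\<lambda>x. as n x - a x)"
    by (simp add: shift_def)
  also have "(\<lambda>x. shift (ws n) a x - shift w a x) = shift w (\<lambda>x. shift (ws n - w) a x - a x)"
    by (simp add: shift_def algebra_simps)
  also have "L1_norm (shift (ws n) (\<lambda>x. as n x - a x)) + L1_norm (shift w (\<lambda>x. shift (ws n - w) a x - a x)) = ?f n"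
    by (subst (1 2) L1_norm_shift) auto
  finally show "L1_norm (\<lambda>x. shift (ws n) (as n) x - shift w a x) \<le> ?f n" .
qed

section \<open>Convolution with a bounded kernel\<close>

text \<open>A non-integrable function has integral 0 by convention, so integral 1 forces
  integrability.\<close>

lemma kernels_integrable:
  assumes "\<kappa> \<in> kernels"
  shows "integrable lborel \<kappa>"
  using assms not_integrable_integral_eq[of lborel \<kappa>] by (auto simp: kernels_def)

lemma kernels_measurable: "\<kappa> \<in> kernels \<Longrightarrow> \<kappa> \<in> borel_measurable borel"
  by (simp add: kernels_def)

lemma kernels_bound:
  assumes "\<kappa> \<in> kernels"
  obtains C where "0 \<le> C" "AE x in lborel. \<bar>\<kappa> x\<bar> \<le> C"
proof -
  obtain C where C: "AE x in lborel. \<bar>\<kappa> x\<bar> \<le> C"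
    using assms by (auto simp: kernels_def)
  show thesis
    by (rule that[of "max 0 C"]) (use C in \<open>auto elim: eventually_mono\<close>)
qed

text \<open>The reflected and scaled \<open>a\<close> is a majorant for every \<open>x\<close>, so
  the integral defining \<open>conv\<close> is a genuine one at every point, not just almost
  everywhere.\<close>

lemma conv_integrand_integrable:
  assumes "\<kappa> \<in> kernels" "a \<in> L1"
  shows "integrable lborel (\<lambda>y. \<kappa> y * a (x - y))"
proof -
  note [measurable] = kernels_measurable[OF assms(1)] L1_measurable[OF assms(2)]
  obtain C where C: "0 \<le> C" "AE x in lborel. \<bar>\<kappa> x\<bar> \<le> C"
    using kernels_bound[OF assms(1)] .
  have "integrable lborel (\<lambda>y. C * a (x - y))"
    using assms(2) by (intro integrable_mult_right integrable_lborel_reflect) (auto simp: L1_def)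
  then show ?thesis
  proof (rule Bochner_Integration.integrable_bound)
    show "AE y in lborel. norm (\<kappa> y * a (x - y)) \<le> norm (C * a (x - y))"
      using C(2) by eventually_elim (use C(1) in \<open>auto simp: abs_mult intro: mult_right_mono\<close>)
  qed measurable
qed

text \<open>Hoelder's inequality for the pair of exponents infinity and 1. The bound does not depend
  on \<open>x\<close>, so L1 convergence of configurations gives uniform convergence of their
  convolutions.\<close>

lemma conv_diff_bound:
  assumes "\<kappa> \<in> kernels" "AE x in lborel. \<bar>\<kappa> x\<bar> \<le> C" "a \<in> L1" "b \<in> L1"
  shows "\<bar>conv \<kappa> a x - conv \<kappa> b x\<bar> \<le> C * (LINT y|lborel. \<bar>a y - b y\<bar>)"
proof -
  note [measurable] = kernels_measurable[OF assms(1)] assms(3,4)[THEN L1_measurable]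
  have int: "integrable lborel (\<lambda>y. C * \<bar>a (x - y) - b (x - y)\<bar>)"
    using integrable_lborel_reflect[of a x] integrable_lborel_reflect[of b x] assms(3,4)
    by (intro integrable_mult_right integrable_abs Bochner_Integration.integrable_diff) (auto simp: L1_def)
  have int': "integrable lborel (\<lambda>y. \<kappa> y * (a (x - y) - b (x - y)))"
    using conv_integrand_integrable[OF assms(1,3)] conv_integrand_integrable[OF assms(1,4)]
    by (simp add: right_diff_distrib)
  have "conv \<kappa> a x - conv \<kappa> b x = (LINT y|lborel. \<kappa> y * (a (x - y) - b (x - y)))"
    using conv_integrand_integrable[OF assms(1,3)] conv_integrand_integrable[OF assms(1,4)]
    by (simp add: conv_def right_diff_distrib)
  also have "\<bar>\<dots>\<bar> \<le> (LINT y|lborel. \<bar>\<kappa> y * (a (x - y) - b (x - y))\<bar>)"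
    by (rule integral_abs_bound)
  also have "\<dots> \<le> (LINT y|lborel. C * \<bar>a (x - y) - b (x - y)\<bar>)"
  proof (rule integral_mono_AE)
    show "AE y in lborel. \<bar>\<kappa> y * (a (x - y) - b (x - y))\<bar> \<le> C * \<bar>a (x - y) - b (x - y)\<bar>"
      using assms(2) by eventually_elim (auto simp: abs_mult intro: mult_right_mono)
  qed (use int int' in auto)
  also have "\<dots> = C * (LINT y|lborel. \<bar>a y - b y\<bar>)"
    using integral_lborel_reflect[of "\<lambda>y. \<bar>a y - b y\<bar>" x] by simp
  finally show ?thesis .
qed

text \<open>For each fixed \<open>x\<close> the two integrands differ only on a reflected null set.
  Hence the set of points where the convolution hits a threshold depends only on the class of the
  configuration.\<close>

lemma conv_cong:
  assumes "L1_eq a b" "a \<in> L1" "b \<in> L1" "\<kappa> \<in> kernels"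
  shows "conv \<kappa> a = conv \<kappa> b"
proof
  fix x
  note [measurable] = assms(2,3)[THEN L1_measurable] kernels_measurable[OF assms(4)]
  have "AE y in lborel. a (x - y) = b (x - y)"
    using assms(1) unfolding L1_eq_def by (rule AE_lborel_reflect)
  then show "conv \<kappa> a x = conv \<kappa> b x"
    unfolding conv_def by (intro integral_cong_AE) (auto elim: eventually_mono)
qed

lemma conv_measurable:
  assumes "\<kappa> \<in> kernels" "a \<in> L1"
  shows "conv \<kappa> a \<in> borel_measurable borel"
proof -
  note [measurable] = kernels_measurable[OF assms(1)] L1_measurable[OF assms(2)]
  show ?thesis unfolding conv_def[abs_def] by measurable
qed

text \<open>Fubini: integrating \<open>\<bar>\<kappa> y * a (x - y)\<bar>\<close> over
  \<open>x\<close> first gives \<open>\<bar>\<kappa> y\<bar>\<close> times the norm of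
  \<open>a\<close>, which is integrable in \<open>y\<close>.\<close>

lemma conv_L1:
  assumes "\<kappa> \<in> kernels" "a \<in> L1"
  shows "conv \<kappa> a \<in> L1"
proof -
  note [measurable] = kernels_measurable[OF assms(1)] L1_measurable[OF assms(2)]
  have \<kappa>: "integrable lborel \<kappa>" and a: "integrable lborel a"
    using assms kernels_integrable by (auto simp: L1_def)
  have trans: "integrable lborel (\<lambda>x. a (x - y))" for y
    using integrable_lborel_translate[OF a, of "- y"] by simp
  have trans_eq: "(LINT x|lborel. \<bar>a (x - y)\<bar>) = (LINT x|lborel. \<bar>a x\<bar>)" for y
    using integral_lborel_translate[of "\<lambda>x. \<bar>a x\<bar>" "- y"] by simp
  have "integrable (lborel \<Otimes>\<^sub>M lborel) (\<lambda>(y, x). \<kappa> y * a (x - y))"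
  proof (rule lborel_pair.Fubini_integrable)
    show "integrable lborel (\<lambda>y. LINT x|lborel. norm (case (y, x) of (y, x) \<Rightarrow> \<kappa> y * a (x - y)))"
      using \<kappa> by (auto simp: abs_mult trans_eq)
    show "AE y in lborel. integrable lborel (\<lambda>x. case (y, x) of (y, x) \<Rightarrow> \<kappa> y * a (x - y))"
      using trans by simp
  qed measurable
  from lborel_pair.integrable_snd[OF this] show ?thesis
    by (simp add: L1_def conv_def[abs_def])
qed

lemma conv_shift: "conv \<kappa> (shift v a) = shift v (conv \<kappa> a)"
  by (simp add: conv_def shift_def fun_eq_iff algebra_simps)

section \<open>The RealLife automaton as a map of L1\<close>

lemma reallife_shift: "reallife \<theta> \<kappa> (shift v a) = shift v (reallife \<theta> \<kappa> a)"
  by (cases \<theta>) (simp add: fun_eq_iff reallife_def conv_shift, simp add: reallife_def shift_def)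

lemma reallife_cong:
  assumes "L1_eq a b" "a \<in> L1" "b \<in> L1" "\<kappa> \<in> kernels"
  shows "L1_eq (reallife \<theta> \<kappa> a) (reallife \<theta> \<kappa> b)"
  using assms(1) conv_cong[OF assms] unfolding L1_eq_def
  by (auto simp: reallife_def elim: eventually_mono)

lemma reallife_measurable:
  assumes "\<kappa> \<in> kernels" "a \<in> L1"
  shows "reallife \<theta> \<kappa> a \<in> borel_measurable borel"
proof (cases \<theta>)
  case (fields s0 b0 b1 s1)
  note [measurable] = L1_measurable[OF assms(2)] conv_measurable[OF assms]
  show ?thesis
    unfolding reallife_def[abs_def] fields prod.case by measurable
qed

text \<open>
  The birth region \<open>{x. b\<^sub>0 \<le> \<kappa> * a(x)}\<close> has finite measure by Markov's inequality, since
  \<open>\<kappa> * a\<close> is integrable and \<open>b\<^sub>0 > 0\<close>; this gives an integrable majorant.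
\<close>

lemma local_rule_bound:
  fixes u c d :: real
  assumes "0 < d" "S \<in> {0, 1}" "B \<in> {0, 1}" "B = 1 \<Longrightarrow> d \<le> c"
  shows "\<bar>u * S + (1 - u) * B\<bar> \<le> 2 * \<bar>u\<bar> + \<bar>c\<bar> / d"
proof -
  have "B \<le> \<bar>c\<bar> / d"
    using assms by (auto simp: field_simps)
  then show ?thesis
    using assms(2,3) by auto
qed

lemma reallife_L1:
  assumes "(s0, b0, b1, s1) \<in> Theta" "\<kappa> \<in> kernels" "a \<in> L1"
  shows "reallife (s0, b0, b1, s1) \<kappa> a \<in> L1"
proof -
  have "integrable lborel (\<lambda>x. 2 * \<bar>a x\<bar> + \<bar>conv \<kappa> a x\<bar> / b0)"
    using conv_L1[OF assms(2,3)] assms(3) by (auto simp: L1_def)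
  then have "integrable lborel (reallife (s0, b0, b1, s1) \<kappa> a)"
  proof (rule Bochner_Integration.integrable_bound)
    show "AE x in lborel. norm (reallife (s0, b0, b1, s1) \<kappa> a x) \<le> norm (2 * \<bar>a x\<bar> + \<bar>conv \<kappa> a x\<bar> / b0)"
    proof (rule AE_I2)
      fix x
      have "\<bar>reallife (s0, b0, b1, s1) \<kappa> a x\<bar> \<le> 2 * \<bar>a x\<bar> + \<bar>conv \<kappa> a x\<bar> / b0"
        unfolding reallife_def prod.case
        by (rule local_rule_bound) (use assms(1) in \<open>auto simp: Theta_def indicator_def split: if_splits\<close>)
      then show "norm (reallife (s0, b0, b1, s1) \<kappa> a x) \<le> norm (2 * \<bar>a x\<bar> + \<bar>conv \<kappa> a x\<bar> / b0)"
        by simp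
    qed
    show "reallife (s0, b0, b1, s1) \<kappa> a \<in> borel_measurable lborel"
      using reallife_measurable[OF assms(2,3)] by simp
  qed
  then show ?thesis by (simp add: L1_def)
qed

section \<open>Joint continuity in the parameters and the configuration\<close>

text \<open>Away from the limit endpoints, \<open>cs n - ls n\<close> and \<open>us n - cs n\<close>
  eventually have the sign of their nonzero limits, so the indicator is eventually constant although
  interval and point both move.\<close>

lemma tendsto_indicator_Icc:
  fixes l u c :: real
  assumes "ls \<longlonglongrightarrow> l" "us \<longlonglongrightarrow> u" "cs \<longlonglongrightarrow> c" "c \<noteq> l" "c \<noteq> u"
  shows "(\<lambda>n. indicat_real {ls n..us n} (cs n)) \<longlonglongrightarrow> indicat_real {l..u} c"
proof (rule tendsto_eventually)
  have "eventually (\<lambda>n. (ls n \<le> cs n) = (l \<le> c)) sequentially"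
  proof (cases "l < c")
    case True
    with tendsto_diff[OF assms(3,1)] have "eventually (\<lambda>n. cs n - ls n > 0) sequentially"
      by (intro order_tendstoD) auto
    then show ?thesis by eventually_elim (use True in auto)
  next
    case False
    with tendsto_diff[OF assms(3,1)] assms(4) have "eventually (\<lambda>n. cs n - ls n < 0) sequentially"
      by (intro order_tendstoD) auto
    then show ?thesis by eventually_elim (use False assms(4) in auto)
  qed
  moreover have "eventually (\<lambda>n. (cs n \<le> us n) = (c \<le> u)) sequentially"
  proof (cases "c < u")
    case True
    with tendsto_diff[OF assms(2,3)] have "eventually (\<lambda>n. us n - cs n > 0) sequentially"
      by (intro order_tendstoD) auto
    then show ?thesis by eventually_elim (use True in auto)
  next
    case False
    with tendsto_diff[OF assms(2,3)] assms(5) have "eventually (\<lambda>n. us n - cs n < 0) sequentially"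
      by (intro order_tendstoD) auto
    then show ?thesis by eventually_elim (use False assms(5) in auto)
  qed
  ultimately show "eventually (\<lambda>n. indicat_real {ls n..us n} (cs n) = indicat_real {l..u} c) sequentially"
    by eventually_elim (auto simp: indicator_def)
qed

lemma L1_tendsto_iff_integral:
  assumes "\<And>n. as n \<in> L1" "a \<in> L1"
  shows "L1_tendsto as a \<longleftrightarrow> (\<lambda>n. LINT x|lborel. \<bar>as n x - a x\<bar>) \<longlonglongrightarrow> 0"
  unfolding L1_tendsto_def
  using assms by (subst L1_norm_eq_integral) (auto intro: L1_diff simp: ennreal_tendsto_0_iff)

text \<open>The comparison function \<open>u n\<close> keeps the state \<open>a\<close> but uses the
  thresholds and the convolution of stage \<open>n\<close>. It converges to the limit by dominated
  convergence, and its distance to stage \<open>n\<close> is at most that of \<open>as n\<close> and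
  \<open>a\<close>.\<close>

lemma reallife_tendsto:
  fixes a :: "real ^ 'd \<Rightarrow> real"
  assumes \<kappa>: "\<kappa> \<in> kernels" and \<theta>: "(s0, b0, b1, s1) \<in> Theta"
    and lims: "s0s \<longlonglongrightarrow> s0" "b0s \<longlonglongrightarrow> b0" "b1s \<longlonglongrightarrow> b1" "s1s \<longlonglongrightarrow> s1"
    and as: "\<And>n. as n \<in> L1" and a: "a \<in> L1" and conv: "L1_tendsto as a"
    and crit: "AE x in lborel. conv \<kappa> a x \<notin> {s0, b0, b1, s1}"
  shows "L1_tendsto (\<lambda>n. reallife (s0s n, b0s n, b1s n, s1s n) \<kappa> (as n)) (reallife (s0, b0, b1, s1) \<kappa> a)"
proof -
  note [measurable] = a[THEN L1_measurable] as[THEN L1_measurable] conv_measurable[OF \<kappa> a]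
    conv_measurable[OF \<kappa> as] reallife_measurable[OF \<kappa> a] reallife_measurable[OF \<kappa> as]
  define S where "S n x = indicat_real {s0s n..s1s n} (conv \<kappa> (as n) x)" for n x
  define B where "B n x = indicat_real {b0s n..b1s n} (conv \<kappa> (as n) x)" for n x
  define u where "u n x = a x * S n x + (1 - a x) * B n x" for n x
  have [measurable]: "S n \<in> borel_measurable borel" "B n \<in> borel_measurable borel" for n
    unfolding S_def[abs_def] B_def[abs_def] by measurable
  have [measurable]: "u n \<in> borel_measurable borel" for n
    unfolding u_def[abs_def] by measurable
  let ?\<Upsilon> = "reallife (s0, b0, b1, s1) \<kappa> a"
  have "b0 > 0" using \<theta> by (auto simp: Theta_def)
  obtain C where C: "AE x in lborel. \<bar>\<kappa> x\<bar> \<le> C"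
    using kernels_bound[OF \<kappa>] .
  define \<delta> where "\<delta> n = C * (LINT y|lborel. \<bar>as n y - a y\<bar>)" for n
  have \<delta>: "\<delta> \<longlonglongrightarrow> 0"
    using conv tendsto_mult_left[of "\<lambda>n. LINT y|lborel. \<bar>as n y - a y\<bar>" 0 sequentially C]
    unfolding L1_tendsto_iff_integral[OF as a] \<delta>_def[abs_def] by simp
  have close: "\<bar>conv \<kappa> (as n) x - conv \<kappa> a x\<bar> \<le> \<delta> n" for n x
    unfolding \<delta>_def by (rule conv_diff_bound[OF \<kappa> C as a])
  have conv_lim: "(\<lambda>n. conv \<kappa> (as n) x) \<longlonglongrightarrow> conv \<kappa> a x" for x
    using close by (intro Lim_transform_bound[OF _ \<delta>] LIM_zero_cancel[OF Lim_null_comparison[OF _ \<delta>]]) auto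
  \<comment> \<open>For large \<open>n\<close>, a birth at \<open>x\<close> forces
    \<open>conv \<kappa> a x \<ge> b0s n - \<delta> n > b0 / 2\<close>, a threshold free of
    \<open>n\<close>. This makes \<open>?w\<close> a common majorant of the tail from
    \<open>N\<close> on.\<close>
  have "(\<lambda>n. b0s n - \<delta> n) \<longlonglongrightarrow> b0 - 0"
    by (intro tendsto_diff lims \<delta>)
  then have "eventually (\<lambda>n. b0s n - \<delta> n > b0 / 2) sequentially"
    using \<open>b0 > 0\<close> by (intro order_tendstoD) auto
  then obtain N where N: "\<And>n. n \<ge> N \<Longrightarrow> b0s n - \<delta> n > b0 / 2"
    by (auto simp: eventually_sequentially)
  let ?w = "\<lambda>x. 2 * \<bar>a x\<bar> + \<bar>conv \<kappa> a x\<bar> / (b0 / 2)"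
  have "(\<lambda>n. \<integral>\<^sup>+x. norm (?\<Upsilon> x - u (n + N) x) \<partial>lborel) \<longlonglongrightarrow> 0"
  proof (rule nn_integral_dominated_convergence_norm[where w = ?w])
    show "AE x in lborel. norm (u (n + N) x) \<le> ?w x" for n
    proof (rule AE_I2)
      fix x
      have "b0 / 2 \<le> conv \<kappa> a x" if "B (n + N) x = 1"
        using that N[of "n + N"] close[of "n + N" x] by (auto simp: B_def indicator_def split: if_splits)
      then show "norm (u (n + N) x) \<le> ?w x"
        unfolding u_def real_norm_def using \<open>b0 > 0\<close>
        by (intro local_rule_bound) (auto simp: S_def B_def indicator_def)
    qed
    have "integrable lborel ?w"
      using conv_L1[OF \<kappa> a] a by (auto simp: L1_def)
    then show "(\<integral>\<^sup>+x. ennreal (?w x) \<partial>lborel) < \<infinity>"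
      using \<open>b0 > 0\<close> by (subst nn_integral_eq_integral) auto
    show "AE x in lborel. (\<lambda>n. u (n + N) x) \<longlonglongrightarrow> ?\<Upsilon> x"
      using crit
    proof eventually_elim
      case (elim x)
      have "(\<lambda>n. u n x) \<longlonglongrightarrow> ?\<Upsilon> x"
        unfolding u_def S_def B_def reallife_def prod.case using elim
        by (intro tendsto_intros tendsto_indicator_Icc lims conv_lim) auto
      then show ?case by (rule LIMSEQ_ignore_initial_segment)
    qed
  qed (use reallife_measurable[OF \<kappa> a] in auto)
  then have "(\<lambda>n. \<integral>\<^sup>+x. norm (?\<Upsilon> x - u n x) \<partial>lborel) \<longlonglongrightarrow> 0"
    by (rule LIMSEQ_offset)
  then have "(\<lambda>n. L1_norm (\<lambda>x. u n x - ?\<Upsilon> x)) \<longlonglongrightarrow> 0"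
    by (simp add: L1_norm_def abs_minus_commute)
  from tendsto_add[OF conv[unfolded L1_tendsto_def] this]
  have lim: "(\<lambda>n. L1_norm (\<lambda>x. as n x - a x) + L1_norm (\<lambda>x. u n x - ?\<Upsilon> x)) \<longlonglongrightarrow> 0"
    by simp
  show ?thesis
  proof (rule L1_tendsto_squeeze[OF _ lim])
    fix n
    let ?\<Upsilon>n = "reallife (s0s n, b0s n, b1s n, s1s n) \<kappa> (as n)"
    show "L1_norm (\<lambda>x. ?\<Upsilon>n x - ?\<Upsilon> x) \<le> L1_norm (\<lambda>x. as n x - a x) + L1_norm (\<lambda>x. u n x - ?\<Upsilon> x)"
    proof (rule L1_norm_triangle; (rule AE_I2)?)
      fix x
      \<comment> \<open>The rule is affine in the state; its slope is the difference of two
        indicators and so lies between -1 and 1.\<close>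
      have "?\<Upsilon>n x - u n x = (as n x - a x) * (S n x - B n x)"
        unfolding u_def reallife_def prod.case S_def[symmetric] B_def[symmetric] by algebra
      moreover have "\<bar>S n x - B n x\<bar> \<le> 1"
        by (auto simp: S_def B_def indicator_def)
      ultimately have "\<bar>?\<Upsilon>n x - u n x\<bar> \<le> \<bar>as n x - a x\<bar>"
        by (simp add: abs_mult mult_left_le)
      then show "\<bar>?\<Upsilon>n x - ?\<Upsilon> x\<bar> \<le> \<bar>as n x - a x\<bar> + \<bar>u n x - ?\<Upsilon> x\<bar>"
        by linarith
    qed measurable
  qed
qed

section \<open>Configurations that almost never meet a threshold\<close>

lemma configs0_subset_L1: "configs0 \<theta> \<kappa> \<subseteq> L1"
  by (auto simp: configs0_def configs1_def split: prod.splits)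

text \<open>The function \<open>a\<close> need not itself take values in {0, 1}, but its convolution
  agrees everywhere with that of a member of \<open>configs0\<close> in the same class.\<close>

lemma L1_classes_configs0_AE:
  assumes "a \<in> L1_classes (configs0 (s0, b0, b1, s1) \<kappa>)" "\<kappa> \<in> kernels"
  shows "AE x in lborel. conv \<kappa> a x \<notin> {s0, b0, b1, s1}"
proof -
  obtain b where b: "b \<in> configs0 (s0, b0, b1, s1) \<kappa>" "L1_eq a b" "a \<in> L1"
    using assms(1) by (auto simp: L1_classes_def)
  then have "conv \<kappa> a = conv \<kappa> b"
    using configs0_subset_L1[THEN subsetD, OF b(1)] assms(2) by (intro conv_cong) auto
  moreover have "{x. conv \<kappa> b x \<in> {s0, b0, b1, s1}} \<in> null_sets lborel"
    using b(1) by (simp add: configs0_def)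
  ultimately show ?thesis
    using AE_not_in[of "{x. conv \<kappa> b x \<in> {s0, b0, b1, s1}}" lborel] by simp
qed

text \<open>Convolution commutes with translation, so the critical set is merely translated and
  stays null.\<close>

lemma configs0_shift:
  assumes "a \<in> configs0 \<theta> \<kappa>" "\<kappa> \<in> kernels"
  shows "shift v a \<in> configs0 \<theta> \<kappa>"
proof (cases \<theta>)
  case (fields s0 b0 b1 s1)
  let ?F = "{s0, b0, b1, s1}"
  have a: "a \<in> L1" "a \<in> configs" "{x. conv \<kappa> a x \<in> ?F} \<in> null_sets lborel"
    using assms(1) by (auto simp: configs0_def configs1_def fields)
  have sv: "shift v a \<in> L1" using a(1) by (rule L1_shift)
  \<comment> \<open>Turning almost-everywhere avoidance back into a null set requires the critical
    set to be Borel; it is the preimage of a finite set.\<close>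
  have sets: "{x. conv \<kappa> (shift v a) x \<in> ?F} \<in> sets borel"
    using measurable_sets[OF conv_measurable[OF assms(2) sv], of ?F] by (simp add: vimage_def)
  have "AE x in lborel. conv \<kappa> a x \<notin> ?F"
    using AE_not_in[OF a(3)] by simp
  then have "AE x in lborel. shift v (conv \<kappa> a) x \<notin> ?F"
    unfolding shift_def by (rule AE_lborel_translate)
  then have "AE x in lborel. conv \<kappa> (shift v a) x \<notin> ?F"
    by (simp only: conv_shift)
  with sets have "{x. conv \<kappa> (shift v a) x \<in> ?F} \<in> null_sets lborel"
    by (subst AE_iff_null_sets) auto
  moreover have "shift v a \<in> configs"
    using a(2) by (auto simp: configs_def shift_def)
  ultimately show ?thesis
    using sv by (simp add: configs0_def configs1_def fields)
qed

lemma shift_invariant_configs0: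
  assumes "\<kappa> \<in> kernels"
  shows "shift_invariant (configs0 \<theta> \<kappa>)"
  unfolding shift_invariant_def L1_classes_def
proof (safe, goal_cases)
  case (1 v a b)
  then show ?case by (simp add: L1_shift)
next
  case (2 v a b)
  then have "L1_eq (shift v a) (shift v b)"
    unfolding L1_eq_def shift_def by (intro AE_lborel_translate)
  then show ?case
    using configs0_shift[OF 2(2) assms] by blast
qed

section \<open>From one-step continuity to evolution\<close>

lemma funpow_L1:
  assumes "L1_map \<Phi>" "a \<in> L1"
  shows "(\<Phi> ^^ p) a \<in> L1"
  using assms by (induction p) (auto simp: L1_map_def)

text \<open>Each application of \<open>step\<close> needs only the current limit
  \<open>(\<Phi> ^^ p) a\<close> to lie in the classes of \<open>A\<close>; the approximating
  iterates just have to stay in L1. Nothing is asked of the last iterate, hence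
  \<open>p<P\<close>.\<close>

lemma L1_tendsto_funpow:
  assumes "\<And>n. L1_map (\<Phi>s n)" "L1_map \<Phi>"
    and step: "\<And>as a. (\<And>n. as n \<in> L1) \<Longrightarrow> a \<in> L1_classes A \<Longrightarrow> L1_tendsto as a \<Longrightarrow>
      L1_tendsto (\<lambda>n. \<Phi>s n (as n)) (\<Phi> a)"
    and "\<And>n. as n \<in> L1" "L1_tendsto as a"
    and "\<forall>p<P. (\<Phi> ^^ p) a \<in> L1_classes A"
  shows "L1_tendsto (\<lambda>n. (\<Phi>s n ^^ P) (as n)) ((\<Phi> ^^ P) a)"
  using assms(6)
proof (induction P)
  case (Suc P)
  have "L1_tendsto (\<lambda>n. \<Phi>s n ((\<Phi>s n ^^ P) (as n))) (\<Phi> ((\<Phi> ^^ P) a))"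
    using Suc assms(1,4) by (intro step funpow_L1) auto
  then show ?case by simp
qed (use assms(5) in simp)

text \<open>Reduces evolution to sequential continuity along the family at points of
  \<open>A\<close>. Travelling patterns are the general case: zero velocity gives periodic points,
  and these with period 1 give fixed points.\<close>

lemma evolves_to_onI:
  assumes maps: "\<And>n. L1_map (\<Phi>s n)" "L1_map \<Phi>"
    and "\<And>n. commutes_with_shifts (\<Phi>s n)" "commutes_with_shifts \<Phi>"
    and "A \<subseteq> L1" "shift_invariant A"
    and step: "\<And>as a. (\<And>n. as n \<in> L1) \<Longrightarrow> a \<in> L1_classes A \<Longrightarrow> L1_tendsto as a \<Longrightarrow>
      L1_tendsto (\<lambda>n. \<Phi>s n (as n)) (\<Phi> a)"
  shows "evolves_to_on \<Phi>s \<Phi> A"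
proof -
  have travel: "L1_eq ((\<Phi> ^^ P) a) (shift (real P *\<^sub>R v) a)"
    if as: "\<And>n. as n \<in> L1" and a: "a \<in> L1_classes A" and lim: "L1_tendsto as a"
      and "\<forall>p<P. (\<Phi> ^^ p) a \<in> L1_classes A" and "vs \<longlonglongrightarrow> v"
      and eq: "\<And>n. L1_eq ((\<Phi>s n ^^ P) (as n)) (shift (real P *\<^sub>R vs n) (as n))"
    for as a P vs v
  \<comment> \<open>The iterates and the translates are almost everywhere equal at each
    \<open>n\<close>, so their two limits must coincide.\<close>
  proof (rule L1_tendsto_unique[OF _ _ eq])
    have "a \<in> L1" using a by (simp add: L1_classes_def)
    then show "(\<Phi> ^^ P) a \<in> L1" "shift (real P *\<^sub>R v) a \<in> L1"
      using maps by (auto intro: funpow_L1 L1_shift)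
    show "(\<Phi>s n ^^ P) (as n) \<in> L1" "shift (real P *\<^sub>R vs n) (as n) \<in> L1" for n
      using maps as by (auto intro: funpow_L1 L1_shift)
    show "L1_tendsto (\<lambda>n. (\<Phi>s n ^^ P) (as n)) ((\<Phi> ^^ P) a)"
      using maps step as lim that(4) by (rule L1_tendsto_funpow)
    show "L1_tendsto (\<lambda>n. shift (real P *\<^sub>R vs n) (as n)) (shift (real P *\<^sub>R v) a)"
      using as \<open>a \<in> L1\<close> lim by (rule L1_tendsto_shift) (intro tendsto_intros that(5))
  qed
  have periodic: "L1_eq ((\<Phi> ^^ P) a) a"
    if "\<And>n. as n \<in> L1" "a \<in> L1_classes A" "L1_tendsto as a"
      "\<forall>p<P. (\<Phi> ^^ p) a \<in> L1_classes A" "\<And>n. L1_eq ((\<Phi>s n ^^ P) (as n)) (as n)" for as a P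
    using travel[OF that(1-4) tendsto_const[of 0]] that(5) by (simp add: shift_def)
  have fixed: "L1_eq (\<Phi> a) a"
    if "\<And>n. as n \<in> L1" "a \<in> L1_classes A" "L1_tendsto as a" "\<And>n. L1_eq (\<Phi>s n (as n)) (as n)" for as a
    using periodic[OF that(1-3), of 1] that(2,4) by simp
  show ?thesis
    unfolding evolves_to_on_def
    using assms(1-6) fixed periodic travel by (intro conjI allI impI; (elim conjE)?) blast+
qed

section \<open>Convergence and evolution of RealLife automata with converging thresholds\<close>

theorem theorem1p3:
  fixes \<kappa> :: "real ^ 'd \<Rightarrow> real"
    and s0 b0 b1 s1 :: real
    and s0s b0s b1s s1s :: "nat \<Rightarrow> real"
  assumes "\<kappa> \<in> kernels"
    and "\<And>n. (s0s n, b0s n, b1s n, s1s n) \<in> Theta"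
    and "(\<lambda>n. (s0s n, b0s n, b1s n, s1s n)) \<longlonglongrightarrow> (s0, b0, b1, s1)"
    and "(s0, b0, b1, s1) \<in> Theta"
  shows "(\<forall>a \<in> configs0 (s0, b0, b1, s1) \<kappa>.
            (\<lambda>n. L1_norm (\<lambda>x. reallife (s0s n, b0s n, b1s n, s1s n) \<kappa> a x
                               - reallife (s0, b0, b1, s1) \<kappa> a x)) \<longlonglongrightarrow> 0)
       \<and> evolves_to_on (\<lambda>n. reallife (s0s n, b0s n, b1s n, s1s n) \<kappa>)
           (reallife (s0, b0, b1, s1) \<kappa>) (configs0 (s0, b0, b1, s1) \<kappa>)"
proof
  let ?A = "configs0 (s0, b0, b1, s1) \<kappa>"
  have lims: "s0s \<longlonglongrightarrow> s0" "b0s \<longlonglongrightarrow> b0" "b1s \<longlonglongrightarrow> b1" "s1s \<longlonglongrightarrow> s1"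
    using tendsto_fst[OF assms(3)] tendsto_fst[OF tendsto_snd[OF assms(3)]]
      tendsto_fst[OF tendsto_snd[OF tendsto_snd[OF assms(3)]]]
      tendsto_snd[OF tendsto_snd[OF tendsto_snd[OF assms(3)]]]
    by simp_all
  have step: "L1_tendsto (\<lambda>n. reallife (s0s n, b0s n, b1s n, s1s n) \<kappa> (as n)) (reallife (s0, b0, b1, s1) \<kappa> a)"
    if "\<And>n. as n \<in> L1" "a \<in> L1_classes ?A" "L1_tendsto as a" for as a
    using that assms(1,4) lims
    by (intro reallife_tendsto L1_classes_configs0_AE) (auto simp: L1_classes_def)
  have map: "L1_map (reallife (t0, c0, c1, t1) \<kappa>)" if "(t0, c0, c1, t1) \<in> Theta" for t0 c0 c1 t1
    unfolding L1_map_def using assms(1) that by (auto intro: reallife_L1 reallife_cong)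
  have shifts: "commutes_with_shifts (reallife \<theta> \<kappa>)" for \<theta>
    by (simp add: commutes_with_shifts_def reallife_shift L1_eq_def)
  show "\<forall>a\<in>?A. (\<lambda>n. L1_norm (\<lambda>x. reallife (s0s n, b0s n, b1s n, s1s n) \<kappa> a x
      - reallife (s0, b0, b1, s1) \<kappa> a x)) \<longlonglongrightarrow> 0"
  proof
    fix a assume a: "a \<in> ?A"
    then have "a \<in> L1" using configs0_subset_L1 by blast
    with a have "a \<in> L1_classes ?A" by (auto simp: L1_classes_def L1_eq_def)
    \<comment> \<open>Pointwise convergence of the operators is the one-step continuity applied to
      the constant sequence \<open>a\<close>.\<close>
    with \<open>a \<in> L1\<close> have "L1_tendsto (\<lambda>n. reallife (s0s n, b0s n, b1s n, s1s n) \<kappa> a) (reallife (s0, b0, b1, s1) \<kappa> a)"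
      by (intro step) (auto simp: L1_tendsto_def L1_norm_def)
    then show "(\<lambda>n. L1_norm (\<lambda>x. reallife (s0s n, b0s n, b1s n, s1s n) \<kappa> a x
        - reallife (s0, b0, b1, s1) \<kappa> a x)) \<longlonglongrightarrow> 0"
      by (simp add: L1_tendsto_def)
  qed
  show "evolves_to_on (\<lambda>n. reallife (s0s n, b0s n, b1s n, s1s n) \<kappa>)
      (reallife (s0, b0, b1, s1) \<kappa>) ?A"
    by (rule evolves_to_onI) (use assms in \<open>auto intro: map shifts step configs0_subset_L1[THEN subsetD] shift_invariant_configs0\<close>)
qed

end
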